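(* Consider the MAX cost. Let $G$ be an $s$–$t$ graph whose $s$–$t$ paths $p_1,\dots,p_m$ are pairwise disjoint with $|p_1|\le\dots\le|p_m|$ and $|p_1|=|p_m|$ (all paths have the same length). For every $n,k\ge1$ and every $\alpha>0$: $$\min_{\sigma\in(\Delta(P_{st}))^n}F_n(\sigma,\alpha)=F_n(U_{P_{st}}^n,\alpha)=|p_1|+\frac{\mathcal{E}_{m,n}}{m}k\alpha.$$
   Context: Graph: $G=(V,E,s,t)$ is a finite directed acyclic multigraph ($E$ is a multiset) with source $s$ and sink $t\neq s$, such that $E\ne\emptyset$ and every edge lies on some directed $s$–$t$ path. $P_{st}=\{p_1,\dots,p_m\}$ is the set of directed $s$–$t$ paths; a path is treated as a set of edges, $|p|$ is its number of edges, and "disjoint" means disjoint as edge sets. Strategies: each of the $n$ agents picks a path, giving $a=(a_1,\dots,a_n)\in(P_{st})^n$; the $k$ interceptors pick $d=(d_1,\dots,d_k)\in E^k$. $\Delta X$ is the set of probability distributions on $X$. An element $\sigma=(\sigma_1,\dots,\sigma_n)\in(\Delta(P_{st}))^n$ is identified with the product distribution on $(P_{st})^n$. $U_{P_{st}}$ is the uniform distribution on $P_{st}$ and $U_{P_{st}}^n$ the product of $n$ copies of it. MAX cost: $C(a,d,\alpha)=\max_{i\in[n]}\left(|a_i|+\alpha\sum_{j\in[k]}\mathbf 1\{d_j\in a_i\}\right)$, and $F_n(\sigma,\alpha)=\max_{d\in E^k}\mathbb{E}_{a\sim\sigma}[C(a,d,\alpha)]$. Notation: $\mathcal{E}_{\ell,n}=\ell\left(1-\left(1-\frac1\ell\right)^n\right)$.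 *)

theory Defs
  imports "HOL-Probability.Probability" "Graph_Theory.Arc_Walk"
begin

text \<open>
  Arcs of a \<^typ>\<open>('a, 'b) pre_digraph\<close> are abstract names with a tail and a head, so parallel
  arcs are allowed and stay distinguishable.
\<close>

locale st_graph = fin_digraph G for G :: "('a, 'b) pre_digraph" (structure) +
  fixes s t :: 'a
  assumes acyclic: "\<not> (\<exists>c. cycle c)"
    and source_neq_sink: "s \<noteq> t"
    and arcs_nonempty: "arcs G \<noteq> {}"
    and arc_on_st_path: "e \<in> arcs G \<Longrightarrow> \<exists>q. apath s q t \<and> e \<in> set q"

text \<open>
  A path is treated as its set of arcs. In an acyclic graph this set determines the path, and
  its cardinality is the length of the path.
\<close>

definition st_paths :: "('a, 'b) pre_digraph \<Rightarrow> 'a \<Rightarrow> 'a \<Rightarrow> 'b set set" where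
  "st_paths G s t = {set q |q. pre_digraph.apath G s q t}"

text \<open>
  Agents and interceptors are numbered from 1. A profile \<open>\<sigma>\<close> gives one distribution
  per agent; its values outside \<open>{1..n}\<close> are irrelevant.
\<close>

definition mixed_profiles :: "'b set set \<Rightarrow> nat \<Rightarrow> (nat \<Rightarrow> 'b set pmf) set" where
  "mixed_profiles P n = {\<sigma>. \<forall>i\<in>{1..n}. set_pmf (\<sigma> i) \<subseteq> P}"

definition uniform_profile :: "'b set set \<Rightarrow> nat \<Rightarrow> 'b set pmf" where
  "uniform_profile P = (\<lambda>i. pmf_of_set P)"

definition max_cost :: "nat \<Rightarrow> nat \<Rightarrow> (nat \<Rightarrow> 'b set) \<Rightarrow> (nat \<Rightarrow> 'b) \<Rightarrow> real \<Rightarrow> real" where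
  "max_cost n k a d \<alpha> =
     Max ((\<lambda>i. real (card (a i)) + \<alpha> * (\<Sum>j\<in>{1..k}. indicator (a i) (d j))) ` {1..n})"

definition expected_max_cost ::
  "nat \<Rightarrow> nat \<Rightarrow> (nat \<Rightarrow> 'b set pmf) \<Rightarrow> (nat \<Rightarrow> 'b) \<Rightarrow> real \<Rightarrow> real" where
  "expected_max_cost n k \<sigma> d \<alpha> =
     measure_pmf.expectation (Pi_pmf {1..n} undefined \<sigma>) (\<lambda>a. max_cost n k a d \<alpha>)"

definition worst_cost ::
  "('a, 'b) pre_digraph \<Rightarrow> nat \<Rightarrow> nat \<Rightarrow> (nat \<Rightarrow> 'b set pmf) \<Rightarrow> real \<Rightarrow> real" where
  "worst_cost G n k \<sigma> \<alpha> =
     Max ((\<lambda>d. expected_max_cost n k \<sigma> d \<alpha>) ` ({1..k} \<rightarrow>\<^sub>E arcs G))"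

definition calE :: "nat \<Rightarrow> nat \<Rightarrow> real" where
  "calE l n = real l * (1 - (1 - 1 / real l) ^ n)"

end

theory Submission
  imports Defs
begin

text \<open>
  Given that all paths have the same length, the cost is that length plus \<open>\<alpha>\<close> times the
  largest number of interceptors met by an agent. Interceptors concentrated on one path \<open>q\<close>
  thus contribute \<open>k \<alpha>\<close> times the probability that some agent uses \<open>q\<close>; for the uniform profile
  spreading them out does not help, by bounding the maximum by the sum over used paths.
  For an arbitrary product profile, AM-GM over the paths, applied separately to the factors
  \<open>1 - \<sigma>\<^sub>i q\<close> of each agent, shows that some path is avoided with probability at most
  \<open>(1 - 1/m)\<^sup>n\<close>.
\<close>

text \<open>Encoded as a set of profiles so that it serves both as an event under
  \<open>Pi_pmf\<close> and inside \<open>indicator\<close>.\<close>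

definition visits :: "nat \<Rightarrow> 'c \<Rightarrow> (nat \<Rightarrow> 'c) set" where
  "visits n q = {a. \<exists>i\<in>{1..n}. a i = q}"

section \<open>AM-GM over paths, combined across agents\<close>

lemma prod_le_mean_power:
  fixes f :: "'c \<Rightarrow> real"
  assumes "finite I" "\<And>i. i \<in> I \<Longrightarrow> f i \<ge> 0"
  shows "prod f I \<le> (sum f I / card I) ^ card I"
proof (cases "I = {}")
  case False
  then have c: "card I > 0" using assms(1) by (simp add: card_gt_0_iff)
  have nonneg: "prod f I \<ge> 0" using assms(2) by (rule prod_nonneg)
  have "root (card I) (prod f I) \<le> sum f I / card I"
    using arith_geom_mean[OF assms(1) False assms(2)] c nonneg
    by (simp add: root_powr_inverse sum_divide_distrib)
  then have "root (card I) (prod f I) ^ card I \<le> (sum f I / card I) ^ card I"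
    using c nonneg by (intro power_mono) auto
  then show ?thesis using c nonneg by simp
qed simp

text \<open>If every \<open>q\<close> failed, multiplying over \<open>P\<close> would give a double
  product above \<open>c ^ (card I * card P)\<close>. Grouped by \<open>i\<close> instead, each
  inner product has factors of mean \<open>c\<close>, so AM-GM bounds it by
  \<open>c ^ card P\<close>.\<close>

lemma exists_prod_prod_le:
  fixes x :: "'d \<Rightarrow> 'c \<Rightarrow> real" and c :: real
  assumes P: "finite P" "P \<noteq> {}"
    and x: "\<And>i q. i \<in> I \<Longrightarrow> q \<in> P \<Longrightarrow> 0 \<le> x i q"
    and sum_x: "\<And>i. i \<in> I \<Longrightarrow> (\<Sum>q\<in>P. x i q) = c * card P"
    and c: "c \<ge> 0"
  shows "\<exists>q\<in>P. (\<Prod>i\<in>I. x i q) \<le> c ^ card I"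
proof (rule ccontr)
  assume "\<not> ?thesis"
  then have less: "c ^ card I < (\<Prod>i\<in>I. x i q)" if "q \<in> P" for q using that by force
  have "(\<Prod>q\<in>P. c ^ card I) < (\<Prod>q\<in>P. \<Prod>i\<in>I. x i q)"
  proof -
    obtain q where q: "q \<in> P" using P by blast
    \<comment> \<open>Strictness at one \<open>q\<close> survives multiplication by the other
      factors only if these are positive; being above a power of \<open>c\<close> \<ge> 0 ensures
      this.\<close>
    have "0 < (\<Prod>i\<in>I. x i q')" if "q' \<in> P" for q'
      using less[OF that] c by (meson le_less_trans zero_le_power)
    then show ?thesis
      using less less[OF q] c P(1) by (intro prod_mono_strict[OF q]) (auto simp: less_imp_le)
  qed
  also have "\<dots> = (\<Prod>i\<in>I. \<Prod>q\<in>P. x i q)" by (rule prod.swap)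
  also have "\<dots> \<le> (\<Prod>i\<in>I. c ^ card P)"
  proof (rule prod_mono)
    fix i assume "i \<in> I"
    then show "0 \<le> (\<Prod>q\<in>P. x i q) \<and> (\<Prod>q\<in>P. x i q) \<le> c ^ card P"
      using prod_le_mean_power[OF P(1), of "x i"] x sum_x P by (auto intro: prod_nonneg)
  qed
  finally show False by (simp add: power_mult[symmetric] mult.commute)
qed

text \<open>The complement says that every agent avoids \<open>q\<close>, and its probability
  factors because agents choose independently.\<close>

lemma prob_visits:
  "measure_pmf.prob (Pi_pmf {1..n} dflt \<sigma>) (visits n q) = 1 - (\<Prod>i\<in>{1..n}. 1 - pmf (\<sigma> i) q)"
proof -
  have eq: "visits n q = - Pi {1..n} (\<lambda>_. - {q})" by (auto simp: visits_def Pi_def)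
  have "measure_pmf.prob (\<sigma> i) (- {q}) = 1 - pmf (\<sigma> i) q" for i
    using measure_pmf.prob_compl[of "{q}" "\<sigma> i"] by (simp add: Compl_eq_Diff_UNIV pmf.rep_eq)
  then have "measure_pmf.prob (Pi_pmf {1..n} dflt \<sigma>) (Pi {1..n} (\<lambda>_. - {q}))
      = (\<Prod>i\<in>{1..n}. 1 - pmf (\<sigma> i) q)"
    by (simp add: measure_Pi_pmf_Pi)
  then show ?thesis
    unfolding eq
    using measure_pmf.prob_compl[of "Pi {1..n} (\<lambda>_. - {q})" "Pi_pmf {1..n} dflt \<sigma>"]
    by (simp add: Compl_eq_Diff_UNIV)
qed

text \<open>All that is used of the graph: its arcs are partitioned into nonempty blocks of common
  size \<open>L\<close>.\<close>

locale equal_length_paths =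
  fixes P :: "'b set set" and E :: "'b set" and L :: nat
  assumes finite_P: "finite P" and P_nonempty: "P \<noteq> {}"
    and finite_E: "finite E"
    and Union_P: "\<Union>P = E"
    and disjoint_P: "disjoint P"
    and card_P: "q \<in> P \<Longrightarrow> card q = L"
    and path_nonempty: "q \<in> P \<Longrightarrow> q \<noteq> {}"
begin

section \<open>Expected cost for a fixed placement of interceptors\<close>

lemma set_pmf_profile:
  assumes "\<sigma> \<in> mixed_profiles P n" "i \<in> {1..n}"
  shows "set_pmf (\<sigma> i) \<subseteq> P"
  using assms unfolding mixed_profiles_def by blast

lemma set_Pi_pmf_profile:
  assumes "\<sigma> \<in> mixed_profiles P n" "a \<in> set_pmf (Pi_pmf {1..n} dflt \<sigma>)" "i \<in> {1..n}"
  shows "a i \<in> P"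
  using set_pmf_profile[OF assms(1,3)] assms(2,3) by (fastforce simp: set_Pi_pmf PiE_dflt_def)

lemma integrable_profile [simp]:
  fixes f :: "(nat \<Rightarrow> 'b set) \<Rightarrow> real"
  assumes "\<sigma> \<in> mixed_profiles P n"
  shows "integrable (Pi_pmf {1..n} dflt \<sigma>) f"
proof (rule integrable_measure_pmf_finite)
  have "finite (set_pmf (\<sigma> i))" if "i \<in> {1..n}" for i
    using set_pmf_profile[OF assms that] finite_P by (rule finite_subset)
  then show "finite (set_pmf (Pi_pmf {1..n} dflt \<sigma>))"
    by (auto simp: set_Pi_pmf intro!: finite_PiE_dflt)
qed

text \<open>By disjointness an agent on \<open>q\<close> meets at most the interceptors placed
  there, namely all \<open>k\<close>, and an agent on any other path meets none.\<close>

lemma max_cost_same_path: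
  fixes \<alpha> :: real
  assumes n: "n \<ge> 1" and \<alpha>: "\<alpha> \<ge> 0" and a: "\<And>i. i \<in> {1..n} \<Longrightarrow> a i \<in> P"
    and q: "q \<in> P" and d: "\<And>j. j \<in> {1..k} \<Longrightarrow> d j \<in> q"
  shows "max_cost n k a d \<alpha> = L + \<alpha> * k * indicator (visits n q) a"
proof -
  have ind: "indicat_real (a i) (d j) = (if a i = q then 1 else 0)"
    if "i \<in> {1..n}" "j \<in> {1..k}" for i j
    using d[OF that(2)] a[OF that(1)] q disjoint_P by (auto simp: indicator_def disjoint_def)
  have "real (card (a i)) + \<alpha> * (\<Sum>j\<in>{1..k}. indicat_real (a i) (d j))
      = L + \<alpha> * k * (if a i = q then 1 else 0)" if "i \<in> {1..n}" for i
    using card_P[OF a[OF that]] sum.cong[OF refl ind[OF that], of "{1..k}"] by simp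
  then have "max_cost n k a d \<alpha> = Max ((\<lambda>i. L + \<alpha> * k * (if a i = q then 1 else 0)) ` {1..n})"
    unfolding max_cost_def by (intro arg_cong[where f=Max] image_cong) auto
  also have "\<dots> = L + \<alpha> * k * indicator (visits n q) a"
  proof (cases "a \<in> visits n q")
    case True
    then show ?thesis using \<alpha> by (intro Max_eqI) (auto simp: visits_def)
  next
    case False
    then have "(\<lambda>i. L + \<alpha> * k * (if a i = q then 1 else 0)) ` {1..n} = {real L}"
      using n by (auto simp: visits_def)
    then show ?thesis using False by simp
  qed
  finally show ?thesis .
qed

text \<open>The hits of agent \<open>i\<close> are the summand of the visited path
  \<open>a i\<close>, and the other summands are nonnegative. Unlike the maximum, the sum passes
  through the expectation.\<close>

lemma max_cost_le_sum_visits: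
  fixes \<alpha> :: real
  assumes n: "n \<ge> 1" and \<alpha>: "\<alpha> \<ge> 0" and a: "\<And>i. i \<in> {1..n} \<Longrightarrow> a i \<in> P"
  shows "max_cost n k a d \<alpha>
    \<le> L + \<alpha> * (\<Sum>q\<in>P. (\<Sum>j\<in>{1..k}. indicator q (d j)) * indicator (visits n q) a)"
  unfolding max_cost_def
proof (subst Max_le_iff, simp, use n in simp, safe)
  fix i assume i: "i \<in> {1..n}"
  have "(\<Sum>j\<in>{1..k}. indicator (a i) (d j))
      = (\<Sum>j\<in>{1..k}. indicator (a i) (d j)) * (indicator (visits n (a i)) a :: real)"
    using i by (auto simp: visits_def indicator_def)
  also have "\<dots> \<le> (\<Sum>q\<in>P. (\<Sum>j\<in>{1..k}. indicator q (d j)) * indicator (visits n q) a)"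
    using finite_P a[OF i]
    by (intro member_le_sum[where f="\<lambda>q. (\<Sum>j\<in>{1..k}. indicator q (d j)) * indicator (visits n q) a"])
      (auto intro!: mult_nonneg_nonneg sum_nonneg)
  finally show "real (card (a i)) + \<alpha> * (\<Sum>j\<in>{1..k}. indicator (a i) (d j))
      \<le> L + \<alpha> * (\<Sum>q\<in>P. (\<Sum>j\<in>{1..k}. indicator q (d j)) * indicator (visits n q) a)"
    using card_P[OF a[OF i]] \<alpha> by (simp add: mult_left_mono)
qed

lemma expected_max_cost_same_path:
  fixes \<alpha> :: real
  assumes "n \<ge> 1" "\<alpha> \<ge> 0" and \<sigma>: "\<sigma> \<in> mixed_profiles P n"
    and "q \<in> P" "\<And>j. j \<in> {1..k} \<Longrightarrow> d j \<in> q"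
  shows "expected_max_cost n k \<sigma> d \<alpha> = L + \<alpha> * k * (1 - (\<Prod>i\<in>{1..n}. 1 - pmf (\<sigma> i) q))"
proof -
  have "expected_max_cost n k \<sigma> d \<alpha>
      = measure_pmf.expectation (Pi_pmf {1..n} undefined \<sigma>)
          (\<lambda>a. L + \<alpha> * k * indicator (visits n q) a)"
    unfolding expected_max_cost_def
  proof (rule integral_cong_AE)
    \<comment> \<open>The two integrands are compared only on the support, where every agent's
      choice lies in \<open>P\<close>.\<close>
    show "AE a in measure_pmf (Pi_pmf {1..n} undefined \<sigma>).
        max_cost n k a d \<alpha> = L + \<alpha> * k * indicator (visits n q) a"
      unfolding AE_measure_pmf_iff
    proof
      fix a assume "a \<in> set_pmf (Pi_pmf {1..n} undefined \<sigma>)"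
      from set_Pi_pmf_profile[OF \<sigma> this]
      show "max_cost n k a d \<alpha> = L + \<alpha> * k * indicator (visits n q) a"
        using assms by (intro max_cost_same_path) auto
    qed
  qed (use \<sigma> in \<open>simp_all del: One_nat_def\<close>)
  then show ?thesis using \<sigma> by (simp add: prob_visits del: One_nat_def)
qed

text \<open>Double counting: each interceptor's arc lies on exactly one path.\<close>

lemma sum_hits:
  assumes "\<And>j. j \<in> {1..k} \<Longrightarrow> d j \<in> E"
  shows "(\<Sum>q\<in>P. \<Sum>j\<in>{1..k}. indicator q (d j)) = real k"
proof -
  have "(\<Sum>q\<in>P. indicat_real q e) = 1" if e: "e \<in> E" for e
  proof -
    obtain q where q: "q \<in> P" "e \<in> q" using e Union_P by blast
    then have "(\<Sum>q'\<in>P. indicat_real q' e) = (\<Sum>q'\<in>P. if q' = q then 1 else 0)"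
      using disjoint_P by (intro sum.cong) (auto simp: disjoint_def indicator_def)
    then show ?thesis using q finite_P by simp
  qed
  then have "(\<Sum>j\<in>{1..k}. \<Sum>q\<in>P. indicator q (d j)) = real k" using assms by simp
  then show ?thesis by (subst sum.swap)
qed

lemma uniform_in_mixed_profiles: "uniform_profile P \<in> mixed_profiles P n"
  using finite_P P_nonempty by (auto simp: uniform_profile_def mixed_profiles_def)

lemma expected_max_cost_uniform_le:
  fixes \<alpha> :: real
  assumes "n \<ge> 1" "\<alpha> \<ge> 0" and d: "\<And>j. j \<in> {1..k} \<Longrightarrow> d j \<in> E"
  shows "expected_max_cost n k (uniform_profile P) d \<alpha>
    \<le> L + \<alpha> * k * (1 - (1 - 1 / card P) ^ n)"
proof -
  let ?M = "Pi_pmf {1..n} undefined (uniform_profile P)"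
  let ?N = "\<lambda>q. \<Sum>j\<in>{1..k}. indicator q (d j) :: real"
  note U = uniform_in_mixed_profiles[of n]
  have "expected_max_cost n k (uniform_profile P) d \<alpha>
      \<le> measure_pmf.expectation ?M (\<lambda>a. L + \<alpha> * (\<Sum>q\<in>P. ?N q * indicator (visits n q) a))"
    unfolding expected_max_cost_def
  proof (rule integral_mono_AE)
    show "AE a in measure_pmf ?M. max_cost n k a d \<alpha> \<le> L + \<alpha> * (\<Sum>q\<in>P. ?N q * indicator (visits n q) a)"
      unfolding AE_measure_pmf_iff
    proof
      fix a assume "a \<in> set_pmf ?M"
      from set_Pi_pmf_profile[OF U this]
      show "max_cost n k a d \<alpha> \<le> L + \<alpha> * (\<Sum>q\<in>P. ?N q * indicator (visits n q) a)"
        using assms by (intro max_cost_le_sum_visits) auto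
    qed
  qed (use U in \<open>simp_all del: One_nat_def\<close>)
  also have "\<dots> = L + \<alpha> * (\<Sum>q\<in>P. ?N q * measure_pmf.prob ?M (visits n q))"
    by (simp add: U del: One_nat_def)
  \<comment> \<open>Under the uniform profile the visiting probability is the same for all
    \<open>q\<close>, so it factors out and only the total number of hits remains.\<close>
  also have "(\<Sum>q\<in>P. ?N q * measure_pmf.prob ?M (visits n q))
      = (\<Sum>q\<in>P. ?N q * (1 - (1 - 1 / card P) ^ n))"
    using finite_P P_nonempty
    by (intro sum.cong) (simp_all add: prob_visits uniform_profile_def del: One_nat_def)
  also have "\<dots> = k * (1 - (1 - 1 / card P) ^ n)"
    using sum_hits[OF d] by (simp add: sum_distrib_right[symmetric])
  finally show ?thesis by (simp add: mult.assoc)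
qed

lemma exists_path_avoided_le:
  assumes \<sigma>: "\<sigma> \<in> mixed_profiles P n"
  shows "\<exists>q\<in>P. (\<Prod>i\<in>{1..n}. 1 - pmf (\<sigma> i) q) \<le> (1 - 1 / card P) ^ n"
proof -
  have c: "card P > 0" using finite_P P_nonempty by (simp add: card_gt_0_iff)
  \<comment> \<open>Each agent's masses sum to 1 over \<open>P\<close>, so the avoidance
    probabilities have mean \<open>1 - 1 / card P\<close>, the constant \<open>c\<close> of
    \<open>exists_prod_prod_le\<close>.\<close>
  have "(\<Sum>q\<in>P. 1 - pmf (\<sigma> i) q) = (1 - 1 / card P) * card P" if "i \<in> {1..n}" for i
    using sum_pmf_eq_1[OF finite_P set_pmf_profile[OF \<sigma> that]] c
    by (simp add: sum_subtractf left_diff_distrib)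
  then have "\<exists>q\<in>P. (\<Prod>i\<in>{1..n}. 1 - pmf (\<sigma> i) q) \<le> (1 - 1 / card P) ^ card {1..n}"
    using finite_P P_nonempty c by (intro exists_prod_prod_le) (auto simp: pmf_le_1)
  then show ?thesis by simp
qed

end

section \<open>Worst placement of the interceptors\<close>

lemma worst_cost_ge:
  assumes "finite (arcs G)" "d \<in> {1..k} \<rightarrow>\<^sub>E arcs G"
  shows "expected_max_cost n k \<sigma> d \<alpha> \<le> worst_cost G n k \<sigma> \<alpha>"
  using assms unfolding worst_cost_def by (intro Max_ge) (auto intro: finite_PiE)

locale equal_length_graph = equal_length_paths P "arcs G" L
  for P :: "'b set set" and G :: "('a, 'b) pre_digraph" and L :: nat
begin

lemma worst_cost_ge_path:
  assumes "n \<ge> 1" "\<alpha> \<ge> 0" "\<sigma> \<in> mixed_profiles P n" "q \<in> P"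
  shows "L + \<alpha> * k * (1 - (\<Prod>i\<in>{1..n}. 1 - pmf (\<sigma> i) q)) \<le> worst_cost G n k \<sigma> \<alpha>"
proof -
  obtain e where e: "e \<in> q" using path_nonempty assms by blast
  \<comment> \<open>All interceptors share one arc of \<open>q\<close>, which every agent on
    \<open>q\<close> uses. The restricted lambda makes the placement extensional, as
    \<open>PiE\<close> demands.\<close>
  let ?d = "\<lambda>j\<in>{1..k}. e"
  have "?d \<in> {1..k} \<rightarrow>\<^sub>E arcs G" using e Union_P assms(4) by auto
  moreover have "expected_max_cost n k \<sigma> ?d \<alpha>
      = L + \<alpha> * k * (1 - (\<Prod>i\<in>{1..n}. 1 - pmf (\<sigma> i) q))"
    using assms e by (intro expected_max_cost_same_path) auto
  ultimately show ?thesis using worst_cost_ge[OF finite_E, of ?d k n \<sigma> \<alpha>] by simp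
qed

lemma worst_cost_ge_uniform_value:
  assumes "n \<ge> 1" "\<alpha> \<ge> 0" "\<sigma> \<in> mixed_profiles P n"
  shows "L + \<alpha> * k * (1 - (1 - 1 / card P) ^ n) \<le> worst_cost G n k \<sigma> \<alpha>"
proof -
  obtain q where q: "q \<in> P" "(\<Prod>i\<in>{1..n}. 1 - pmf (\<sigma> i) q) \<le> (1 - 1 / card P) ^ n"
    using exists_path_avoided_le[OF assms(3)] by blast
  then have "L + \<alpha> * k * (1 - (1 - 1 / card P) ^ n)
      \<le> L + \<alpha> * k * (1 - (\<Prod>i\<in>{1..n}. 1 - pmf (\<sigma> i) q))"
    using assms(2) by (intro add_left_mono mult_left_mono) auto
  also have "\<dots> \<le> worst_cost G n k \<sigma> \<alpha>" using assms q(1) by (rule worst_cost_ge_path)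
  finally show ?thesis .
qed

lemma worst_cost_uniform:
  assumes "n \<ge> 1" "\<alpha> \<ge> 0"
  shows "worst_cost G n k (uniform_profile P) \<alpha> = L + \<alpha> * k * (1 - (1 - 1 / card P) ^ n)"
proof (rule antisym)
  \<comment> \<open>An upper bound on \<open>Max\<close> needs at least one placement to
    exist.\<close>
  have "arcs G \<noteq> {}" using Union_P P_nonempty path_nonempty by blast
  then have "{1..k} \<rightarrow>\<^sub>E arcs G \<noteq> {}" by (simp add: PiE_eq_empty_iff)
  then show "worst_cost G n k (uniform_profile P) \<alpha> \<le> L + \<alpha> * k * (1 - (1 - 1 / card P) ^ n)"
    unfolding worst_cost_def using finite_E
    by (intro Max.boundedI) (auto intro!: expected_max_cost_uniform_le assms finite_PiE)
  show "L + \<alpha> * k * (1 - (1 - 1 / card P) ^ n) \<le> worst_cost G n k (uniform_profile P) \<alpha>"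
    using assms uniform_in_mixed_profiles by (rule worst_cost_ge_uniform_value)
qed

end

section \<open>Paths of the graph and the final value\<close>

lemma (in st_graph) Union_st_paths: "\<Union>(st_paths G s t) = arcs G"
proof
  show "\<Union>(st_paths G s t) \<subseteq> arcs G" by (auto simp: st_paths_def apath_def awalk_def)
  show "arcs G \<subseteq> \<Union>(st_paths G s t)" using arc_on_st_path by (force simp: st_paths_def)
qed

text \<open>An empty walk ends where it starts, whereas \<open>s\<close> and \<open>t\<close>
  differ.\<close>

lemma (in st_graph) st_path_nonempty: "q \<in> st_paths G s t \<Longrightarrow> q \<noteq> {}"
  using source_neq_sink by (auto simp: st_paths_def apath_def awalk_def)

theorem theorem13:
  fixes G :: "('a, 'b) pre_digraph" and s t :: 'a
    and p :: "nat \<Rightarrow> 'b set" and m n k :: nat and \<alpha> :: real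
  assumes "st_graph G s t"
    and "bij_betw p {1..m} (st_paths G s t)"
    and "disjoint_family_on p {1..m}"
    and "\<And>i j. 1 \<le> i \<Longrightarrow> i \<le> j \<Longrightarrow> j \<le> m \<Longrightarrow> card (p i) \<le> card (p j)"
    and "card (p 1) = card (p m)"
    and "n \<ge> 1" and "k \<ge> 1" and "\<alpha> > 0"
  shows "uniform_profile (st_paths G s t) \<in> mixed_profiles (st_paths G s t) n
    \<and> (\<forall>\<sigma> \<in> mixed_profiles (st_paths G s t) n.
          worst_cost G n k (uniform_profile (st_paths G s t)) \<alpha> \<le> worst_cost G n k \<sigma> \<alpha>)
    \<and> worst_cost G n k (uniform_profile (st_paths G s t)) \<alpha>
        = real (card (p 1)) + calE m n / real m * real k * \<alpha>"
proof -
  interpret st_graph G s t by fact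
  let ?P = "st_paths G s t"
  have P: "?P = p ` {1..m}" using assms(2) by (simp add: bij_betw_def)
  have card: "card ?P = m" using bij_betw_same_card[OF assms(2)] by simp
  \<comment> \<open>The lengths are squeezed between those of \<open>p 1\<close> and
    \<open>p m\<close>, which agree.\<close>
  have eq: "card (p i) = card (p 1)" if "i \<in> {1..m}" for i
    using assms(4)[of 1 i] assms(4)[of i m] assms(5) that by simp
  interpret equal_length_graph ?P G "card (p 1)"
  proof
    show "finite ?P" by (simp add: P)
    show "?P \<noteq> {}" using Union_st_paths arcs_nonempty by auto
    show "disjoint ?P" unfolding P using assms(3) by (rule disjoint_family_on_disjoint_image)
    show "card q = card (p 1)" if "q \<in> ?P" for q using that eq unfolding P by blast
  qed (simp_all add: Union_st_paths st_path_nonempty)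
  \<comment> \<open>Lets the factor \<open>m\<close> in \<open>calE m n\<close> cancel against the
    division by \<open>m\<close>.\<close>
  have "m > 0" using card finite_P P_nonempty by (auto simp: card_gt_0_iff)
  then have "calE m n / m * k * \<alpha> = \<alpha> * k * (1 - (1 - 1 / card ?P) ^ n)"
    by (simp add: calE_def card)
  then have "worst_cost G n k (uniform_profile ?P) \<alpha>
      = real (card (p 1)) + calE m n / real m * real k * \<alpha>"
    using worst_cost_uniform[of n \<alpha> k] assms(6,8) by simp
  moreover have "worst_cost G n k (uniform_profile ?P) \<alpha> \<le> worst_cost G n k \<sigma> \<alpha>"
    if "\<sigma> \<in> mixed_profiles ?P n" for \<sigma>
    using worst_cost_uniform[of n \<alpha> k] worst_cost_ge_uniform_value[of n \<alpha> \<sigma> k] assms(6,8) that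
    by simp
  ultimately show ?thesis using uniform_in_mixed_profiles by blast
qed

end
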